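(* Endow $\ell^\infty$ with the coordinatewise product. Then the set $\ell^{\infty}\setminus c_0$ is densely strongly $\mathfrak{c}$-algebrable; that is, $(\ell^{\infty}\setminus c_0)\cup\{0\}$ contains a subalgebra of $\ell^\infty$ which is dense in $\ell^\infty$ and is generated by an algebraically independent set of cardinality $\mathfrak{c}$.
   Context: $\ell^{\infty}$ is the real Banach algebra of bounded real sequences (indexed by $\mathbb{N}$) with the uniform norm and the coordinatewise product; $c_0$ is its subspace of sequences converging to zero; $\mathfrak{c}$ is the cardinality of the continuum. A subset $M$ of a Banach algebra $X$ is called densely strongly $\mathfrak{c}$-algebrable if $M\cup\{0\}$ contains a dense subalgebra of $X$ generated by an algebraically independent set of cardinality $\mathfrak{c}$. Subalgebras are not required to contain the unit: the algebra generated by a set $G$ is the linear span of all products $g_1^{n_1}\cdots g_k^{n_k}$ with $k,n_1,\dots,n_k\geq 1$ and $g_1,\dots,g_k\in G$. A set $G$ is algebraically independent if for every $k\ge 1$, every non-zero polynomial $P\in\mathbb{R}[x_1,\dots,x_k]$ with $P(0)=0$, and all pairwise distinct $g_1,\dots,g_k\in G$, one has $P(g_1,\dots,g_k)\neq 0$. *)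

theory Defs
  imports
    "HOL-Analysis.Analysis"
    "HOL-Library.Equipollence"
    "HOL-Library.Poly_Mapping"
begin

section \<open>Bounded continuous functions as a commutative Banach algebra\<close>

lemma times_cont:
  fixes f g :: "'a::topological_space \<Rightarrow> 'b::real_normed_algebra"
  assumes "f \<in> bcontfun" "g \<in> bcontfun"
  shows "(\<lambda>x. f x * g x) \<in> bcontfun"
proof -
  obtain a b where a: "\<And>x. norm (f x) \<le> a" and b: "\<And>x. norm (g x) \<le> b"
    using assms by (auto simp: bcontfun_def bounded_iff)
  have "norm (f x * g x) \<le> a * b" for x
    by (rule order_trans[OF norm_mult_ineq])
      (intro mult_mono a b norm_ge_zero order_trans[OF norm_ge_zero a])
  then show ?thesis
    using assms by (intro bcontfun_normI) (auto simp: bcontfun_def intro!: continuous_intros)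
qed

instantiation bcontfun :: (topological_space, real_normed_algebra) real_normed_algebra
begin

definition times_bcontfun :: "('a \<Rightarrow>\<^sub>C 'b) \<Rightarrow> ('a \<Rightarrow>\<^sub>C 'b) \<Rightarrow> 'a \<Rightarrow>\<^sub>C 'b"
  where "times_bcontfun f g = Bcontfun (\<lambda>x. apply_bcontfun f x * apply_bcontfun g x)"

lemma apply_bcontfun_times [simp]:
  "apply_bcontfun (f * g) x = apply_bcontfun f x * apply_bcontfun g x"
  by (simp add: times_bcontfun_def Bcontfun_inverse times_cont apply_bcontfun)

instance
proof
  fix f g :: "'a \<Rightarrow>\<^sub>C 'b"
  show "norm (f * g) \<le> norm f * norm g"
  proof (rule norm_bound)
    fix x
    show "norm (apply_bcontfun (f * g) x) \<le> norm f * norm g"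
      using norm_mult_ineq[of "apply_bcontfun f x" "apply_bcontfun g x"]
        mult_mono[OF norm_bounded[of f x] norm_bounded[of g x]] by simp
  qed
qed (auto intro!: bcontfun_eqI simp: algebra_simps)

end

instantiation bcontfun :: (topological_space, real_normed_algebra_1) real_normed_algebra_1
begin

definition one_bcontfun :: "'a \<Rightarrow>\<^sub>C 'b"
  where "one_bcontfun = const_bcontfun 1"

lemma apply_bcontfun_one [simp]: "apply_bcontfun 1 x = 1"
  by (simp add: one_bcontfun_def)

instance
proof
  show "(0 :: 'a \<Rightarrow>\<^sub>C 'b) \<noteq> 1"
  proof
    assume "(0 :: 'a \<Rightarrow>\<^sub>C 'b) = 1"
    then have "apply_bcontfun (0 :: 'a \<Rightarrow>\<^sub>C 'b) undefined = apply_bcontfun 1 undefined"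
      by (rule arg_cong)
    then show False by simp
  qed
  show "norm (1 :: 'a \<Rightarrow>\<^sub>C 'b) = 1"
  proof (rule antisym)
    show "norm (1 :: 'a \<Rightarrow>\<^sub>C 'b) \<le> 1"
      by (rule norm_bound) simp
    show "1 \<le> norm (1 :: 'a \<Rightarrow>\<^sub>C 'b)"
      using norm_bounded[of "1 :: 'a \<Rightarrow>\<^sub>C 'b" undefined] by simp
  qed
qed (auto intro!: bcontfun_eqI)

end

instance bcontfun :: (topological_space, "{real_normed_algebra_1, comm_ring_1}") comm_ring_1
  by standard (auto intro!: bcontfun_eqI simp: algebra_simps)

instance bcontfun :: (metric_space, banach) banach ..

text \<open>Completeness of a space of bounded continuous functions is available in the library only over a
  metric domain, hence the following metric on \<open>nat\<close>; it induces the existing (discrete) topology.\<close>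

instantiation nat :: metric_space
begin

definition dist_nat :: "nat \<Rightarrow> nat \<Rightarrow> real"
  where "dist_nat m n = \<bar>real m - real n\<bar>"

definition uniformity_nat :: "(nat \<times> nat) filter"
  where "uniformity_nat = (INF e\<in>{0<..}. principal {(x, y). dist x y < e})"

instance
proof
  fix U :: "nat set"
  have "eventually (\<lambda>(x', y). x' = x \<longrightarrow> y \<in> U) uniformity" if "x \<in> U" for x
    unfolding uniformity_nat_def
  proof (rule eventually_INF1)
    have near: "x = y" if "\<bar>real x - real y\<bar> < 1" for y
      using that by linarith
    show "(1::real) \<in> {0<..}" by simp
    show "eventually (\<lambda>(x', y). x' = x \<longrightarrow> y \<in> U) (principal {(x, y). dist x y < 1})"
      using that by (auto simp: eventually_principal dist_nat_def dest!: near)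
  qed
  then show "open U = (\<forall>x\<in>U. \<forall>\<^sub>F (x', y) in uniformity. x' = x \<longrightarrow> y \<in> U)"
    by (simp add: open_discrete)
qed (auto simp: dist_nat_def uniformity_nat_def)

end


section \<open>Algebrability\<close>

definition subalgebra :: "'a::real_algebra set \<Rightarrow> bool"
  where "subalgebra A \<longleftrightarrow> subspace A \<and> (\<forall>x\<in>A. \<forall>y\<in>A. x * y \<in> A)"

text \<open>Monomials have at least one factor and all exponents are at least 1, so the generated subalgebra need not contain the unit.\<close>

definition monomials_of :: "'a::{real_algebra_1, comm_ring_1} set \<Rightarrow> 'a set"
  where "monomials_of G =
    {\<Prod>i<k. g i ^ n i | (k::nat) (g::nat \<Rightarrow> 'a) (n::nat \<Rightarrow> nat).
      1 \<le> k \<and> (\<forall>i<k. g i \<in> G \<and> 1 \<le> n i)}"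

definition generated_subalgebra :: "'a::{real_algebra_1, comm_ring_1} set \<Rightarrow> 'a set"
  where "generated_subalgebra G = span (monomials_of G)"

text \<open>A real polynomial in countably many variables is a finitely supported map from exponent
  vectors to coefficients; \<open>polys k\<close> consists of those involving only the first \<open>k\<close> variables.\<close>

definition polys :: "nat \<Rightarrow> ((nat \<Rightarrow>\<^sub>0 nat) \<Rightarrow>\<^sub>0 real) set"
  where "polys k = {P. \<forall>m\<in>Poly_Mapping.keys P. Poly_Mapping.keys m \<subseteq> {..<k}}"

definition poly_eval ::
    "nat \<Rightarrow> ((nat \<Rightarrow>\<^sub>0 nat) \<Rightarrow>\<^sub>0 real) \<Rightarrow> (nat \<Rightarrow> 'a) \<Rightarrow> 'a::{real_algebra_1, comm_ring_1}"
  where "poly_eval k P g =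
    (\<Sum>m\<in>Poly_Mapping.keys P.
      Poly_Mapping.lookup P m *\<^sub>R (\<Prod>i<k. g i ^ Poly_Mapping.lookup m i))"

definition alg_independent :: "'a::{real_algebra_1, comm_ring_1} set \<Rightarrow> bool"
  where "alg_independent G \<longleftrightarrow>
    (\<forall>k\<ge>1. \<forall>P\<in>polys k. P \<noteq> 0 \<and> poly_eval k P (\<lambda>_. 0::real) = 0 \<longrightarrow>
      (\<forall>g. inj_on g {..<k} \<and> g ` {..<k} \<subseteq> G \<longrightarrow> poly_eval k P g \<noteq> 0))"

definition densely_strongly_c_algebrable ::
    "'a::{real_normed_algebra_1, comm_ring_1, banach} set \<Rightarrow> bool"
  where "densely_strongly_c_algebrable M \<longleftrightarrow>
    (\<exists>A G. subalgebra A \<and> A \<subseteq> M \<union> {0} \<and> closure A = UNIV \<and>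
      A = generated_subalgebra G \<and> alg_independent G \<and> G \<approx> (UNIV :: real set))"


section \<open>The spaces of bounded sequences and of null sequences\<close>

text \<open>As \<open>nat\<close> carries the discrete topology, every sequence is continuous.\<close>

type_synonym linfty = "nat \<Rightarrow>\<^sub>C real"

lemma linfty_iff: "(\<exists>x::linfty. apply_bcontfun x = f) \<longleftrightarrow> bounded (range f)"
proof
  assume "bounded (range f)"
  then have "f \<in> bcontfun"
    by (simp add: bcontfun_def)
  then show "\<exists>x::linfty. apply_bcontfun x = f"
    by (metis bcontfunE)
qed auto

definition c0 :: "linfty set"
  where "c0 = {x. (\<lambda>n. apply_bcontfun x n) \<longlonglongrightarrow> 0}"


section \<open>Generated subalgebras are the least subalgebras\<close>

lemma monomials_of_mult:
  assumes "x \<in> monomials_of G" "y \<in> monomials_of G"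
  shows "x * y \<in> monomials_of G"
proof -
  obtain k :: nat and g n where x: "x = (\<Prod>i<k. g i ^ n i)" "1 \<le> k" "\<forall>i<k. g i \<in> G \<and> 1 \<le> n i"
    using assms(1) unfolding monomials_of_def mem_Collect_eq by blast
  obtain l :: nat and h m where y: "y = (\<Prod>i<l. h i ^ m i)" "\<forall>i<l. h i \<in> G \<and> 1 \<le> m i"
    using assms(2) unfolding monomials_of_def mem_Collect_eq by blast
  define p where "p i = (if i < k then g i else h (i - k))" for i
  define q where "q i = (if i < k then n i else m (i - k))" for i
  have split: "(\<Prod>i<k + j. p i ^ q i) = x * (\<Prod>i<j. h i ^ m i)" for j
    by (induction j) (simp_all add: x(1) p_def q_def mult_ac)
  have "x * y = (\<Prod>i<k + l. p i ^ q i)"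
    by (simp add: split y(1))
  moreover have "\<forall>i<k + l. p i \<in> G \<and> 1 \<le> q i"
    using x(3) y(2) by (auto simp: p_def q_def)
  ultimately show ?thesis
    using x(2) unfolding monomials_of_def mem_Collect_eq
    by (intro exI[of _ "k + l"] exI[of _ p] exI[of _ q]) simp
qed

lemma subalgebra_generated: "subalgebra (generated_subalgebra G)"
proof -
  have "x * y \<in> span (monomials_of G)"
    if x: "x \<in> span (monomials_of G)" and y: "y \<in> span (monomials_of G)" for x y
    using x
  proof (induction rule: span_induct_alt)
    case base
    then show ?case by (simp add: span_zero)
  next
    case (step c a z)
    from y have "a * y \<in> span (monomials_of G)"
    proof (induction rule: span_induct_alt)
      case base
      then show ?case by (simp add: span_zero)
    next
      case (step d b w)
      have "d *\<^sub>R (a * b) + a * w \<in> span (monomials_of G)"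
        using step \<open>a \<in> monomials_of G\<close>
        by (intro span_add span_scale) (auto intro: span_base monomials_of_mult)
      then show ?case
        by (simp add: distrib_left)
    qed
    with step show ?case
      by (auto simp: distrib_right intro!: span_add span_scale)
  qed
  then show ?thesis
    by (auto simp: subalgebra_def generated_subalgebra_def)
qed

lemma generated_subalgebra_eq_hull: "generated_subalgebra G = subalgebra hull G"
proof (rule hull_unique[symmetric])
  show "G \<subseteq> generated_subalgebra G"
  proof
    fix x assume "x \<in> G"
    then have "x \<in> monomials_of G"
      unfolding monomials_of_def mem_Collect_eq
      by (intro exI[of _ 1] exI[of _ "\<lambda>_. x"] exI[of _ "\<lambda>_. 1"]) simp
    then show "x \<in> generated_subalgebra G"
      by (simp add: generated_subalgebra_def span_base)
  qed
  show "subalgebra (generated_subalgebra G)"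
    by (rule subalgebra_generated)
next
  fix A assume A: "G \<subseteq> A" "subalgebra A"
  have pow: "x ^ Suc n \<in> A" if "x \<in> A" for x n
    using that A(2) by (induction n) (auto simp: subalgebra_def)
  have "(\<Prod>i<Suc k. g i ^ n i) \<in> A" if "\<forall>i<Suc k. g i \<in> G \<and> 1 \<le> n i" for k :: nat and g n
    using that
  proof (induction k)
    case 0
    then have "g 0 \<in> A" "n 0 = Suc (n 0 - 1)"
      using A(1) by auto
    then have "g 0 ^ n 0 \<in> A"
      by (metis pow)
    then show ?case by simp
  next
    case (Suc k)
    then have "g (Suc k) \<in> A" "n (Suc k) = Suc (n (Suc k) - 1)"
      using A(1) by auto
    then have "g (Suc k) ^ n (Suc k) \<in> A"
      by (metis pow)
    moreover have "(\<Prod>i<Suc k. g i ^ n i) \<in> A"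
      using Suc by simp
    ultimately show ?case
      using A(2) by (simp only: prod.lessThan_Suc[of _ "Suc k"] subalgebra_def)
  qed
  then have "monomials_of G \<subseteq> A"
    unfolding monomials_of_def by (clarsimp dest!: Suc_le_D)
  then show "generated_subalgebra G \<subseteq> A"
    using A(2) by (simp add: generated_subalgebra_def span_minimal subalgebra_def)
qed

end

theory Submission
  imports Defs
begin

text \<open>There are continuum many bounded sequences \<open>u\<^sub>b\<close> such that finitely many of them attain any
  prescribed values of the form \<open>1 / q\<close> simultaneously and infinitely often. Perturbing the finitely
  valued sequences by small multiples of distinct \<open>u\<^sub>b\<close> gives a dense set of generators. A polynomial
  in finitely many of them is, on each of finitely many pieces of \<open>\<nat>\<close>, a shifted polynomial in the
  \<open>u\<^sub>b\<close>; at a common non-zero of all the shifts it is infinitely often bounded away from 0.\<close>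

section \<open>Common non-zeros of shifted polynomials\<close>

text \<open>Mixed radix encoding: a new index gets weight 1 and the old weights are multiplied by a
  base \<open>B\<close> above all exponents at the new index, so reduction modulo \<open>B\<close>
  recovers these exponents.\<close>

lemma separating_weights:
  fixes E :: "('i \<Rightarrow> nat) set"
  assumes "finite I" "finite E"
  shows "\<exists>w::'i \<Rightarrow> nat. (\<forall>i\<in>I. 0 < w i) \<and>
    (\<forall>m\<in>E. \<forall>m'\<in>E. (\<Sum>i\<in>I. w i * m i) = (\<Sum>i\<in>I. w i * m' i) \<longrightarrow> (\<forall>i\<in>I. m i = m' i))"
  using assms(1)
proof (induction I rule: finite_induct)
  case empty
  then show ?case by simp
next
  case (insert j I)
  then obtain w :: "'i \<Rightarrow> nat" where pos: "\<forall>i\<in>I. 0 < w i"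
    and sep: "\<And>m m'. m \<in> E \<Longrightarrow> m' \<in> E \<Longrightarrow> (\<Sum>i\<in>I. w i * m i) = (\<Sum>i\<in>I. w i * m' i)
      \<Longrightarrow> \<forall>i\<in>I. m i = m' i"
    by blast
  \<comment> \<open>The sum dominates each exponent; \<open>Suc\<close> keeps \<open>B\<close>
    positive even for empty \<open>E\<close>, so the new weights stay positive.\<close>
  define B where "B = Suc (\<Sum>m\<in>E. m j)"
  define w' where "w' i = (if i = j then 1 else B * w i)" for i
  have small: "m j < B" if "m \<in> E" for m
    using member_le_sum[of m E "\<lambda>m. m j"] that assms(2) by (simp add: B_def less_Suc_eq_le)
  have weight: "(\<Sum>i\<in>insert j I. w' i * m i) = m j + B * (\<Sum>i\<in>I. w i * m i)" for m
  proof -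
    have "(\<Sum>i\<in>I. w' i * m i) = (\<Sum>i\<in>I. B * (w i * m i))"
      using insert.hyps by (intro sum.cong) (auto simp: w'_def)
    then show ?thesis
      using insert.hyps by (simp add: w'_def sum_distrib_left)
  qed
  have "\<forall>i\<in>insert j I. m i = m' i"
    if "m \<in> E" "m' \<in> E" "(\<Sum>i\<in>insert j I. w' i * m i) = (\<Sum>i\<in>insert j I. w' i * m' i)" for m m'
  proof -
    have eq: "m j + B * (\<Sum>i\<in>I. w i * m i) = m' j + B * (\<Sum>i\<in>I. w i * m' i)"
      using that(3) by (simp only: weight)
    then have "(m j + B * (\<Sum>i\<in>I. w i * m i)) mod B = (m' j + B * (\<Sum>i\<in>I. w i * m' i)) mod B"
      by simp
    then have j: "m j = m' j"
      using small that(1,2) by simp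
    then have "(\<Sum>i\<in>I. w i * m i) = (\<Sum>i\<in>I. w i * m' i)"
      using eq by (simp add: B_def del: mult_Suc)
    then show ?thesis
      using sep that(1,2) j by blast
  qed
  moreover have "\<forall>i\<in>insert j I. 0 < w' i"
    using pos by (auto simp: w'_def B_def)
  ultimately show ?case
    by blast
qed

text \<open>Kronecker substitution: the value at \<open>i\<close> is a power \<open>x ^ w i\<close>, the weights being chosen so that
  distinct monomials have distinct degrees in \<open>x\<close>, even after the shifts.\<close>

lemma common_nonzero_of_shifts:
  fixes r :: "'m \<Rightarrow> real" and e :: "'m \<Rightarrow> 'i \<Rightarrow> nat" and d :: "'i \<Rightarrow> real"
  assumes I: "finite I" and K: "finite K" "K \<noteq> {}" and r: "\<And>m. m \<in> K \<Longrightarrow> r m \<noteq> 0"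
    and sep: "\<And>m m'. m \<in> K \<Longrightarrow> m' \<in> K \<Longrightarrow> (\<And>i. i \<in> I \<Longrightarrow> e m i = e m' i) \<Longrightarrow> m = m'"
    and d: "\<And>i. i \<in> I \<Longrightarrow> d i \<noteq> 0" and Z: "finite Z"
  shows "\<exists>q::'i \<Rightarrow> nat. \<forall>z\<in>Z. (\<Sum>m\<in>K. r m * (\<Prod>i\<in>I. (z i + d i * inverse (real (q i))) ^ e m i)) \<noteq> 0"
proof -
  obtain w :: "'i \<Rightarrow> nat" where w: "\<And>i. i \<in> I \<Longrightarrow> 0 < w i"
    and w_sep: "\<And>m m'. m \<in> e ` K \<Longrightarrow> m' \<in> e ` K \<Longrightarrow>
      (\<Sum>i\<in>I. w i * m i) = (\<Sum>i\<in>I. w i * m' i) \<Longrightarrow> \<forall>i\<in>I. m i = m' i"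
    using separating_weights[OF I finite_imageI[OF K(1)], of e] by blast
  define D where "D m = (\<Sum>i\<in>I. w i * e m i)" for m
  \<comment> \<open>\<open>t z m\<close> is the monomial \<open>m\<close> after the shifted
    substitution; its degree \<open>D m\<close> does not depend on the shift
    \<open>z\<close>.\<close>
  define t where "t z m = (\<Prod>i\<in>I. ([:z i:] + monom (d i) (w i)) ^ e m i)" for z m
  define p where "p z = (\<Sum>m\<in>K. smult (r m) (t z m))" for z
  have D_inj: "m = m'" if "m \<in> K" "m' \<in> K" "D m = D m'" for m m'
    using w_sep[of "e m" "e m'"] sep that by (auto simp: D_def)
  have factor: "degree ([:z i:] + monom (d i) (w i)) = w i" "[:z i:] + monom (d i) (w i) \<noteq> 0"
    if "i \<in> I" for i and z :: "'i \<Rightarrow> real"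
  proof -
    show deg: "degree ([:z i:] + monom (d i) (w i)) = w i"
      using w[OF that] d[OF that] by (subst degree_add_eq_right) (auto simp: degree_monom_eq)
    then show "[:z i:] + monom (d i) (w i) \<noteq> 0"
      using w[OF that] by fastforce
  qed
  have t_nz: "t z m \<noteq> 0" for z m
    using factor(2) I by (simp add: t_def)
  have t_deg: "degree (t z m) = D m" for z m
    unfolding t_def D_def
    using factor by (subst degree_prod_eq_sum_degree) (auto simp: degree_power_eq mult.commute intro!: sum.cong)
  have p_nz: "p z \<noteq> 0" for z
  proof -
    \<comment> \<open>As \<open>D\<close> is injective on \<open>K\<close>, only one monomial
      reaches the maximal degree, so its leading term cannot cancel.\<close>
    have "Max (D ` K) \<in> D ` K"
      using K by (intro Max_in) auto
    then obtain m where m: "m \<in> K" "D m = Max (D ` K)"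
      by auto
    have max: "D m' \<le> D m" if "m' \<in> K" for m'
      using that K(1) by (simp add: m(2))
    have "coeff (p z) (D m) = (\<Sum>m'\<in>K. r m' * coeff (t z m') (D m))"
      by (simp add: p_def coeff_sum)
    also have "\<dots> = (\<Sum>m'\<in>{m}. r m' * coeff (t z m') (D m))"
    proof (rule sum.mono_neutral_right)
      show "\<forall>m'\<in>K - {m}. r m' * coeff (t z m') (D m) = 0"
      proof
        fix m' assume m': "m' \<in> K - {m}"
        then have "D m' < D m"
          using max[of m'] m(1) D_inj[of m m'] by (auto simp: le_less)
        then show "r m' * coeff (t z m') (D m) = 0"
          by (simp add: coeff_eq_0 t_deg)
      qed
    qed (use K m in auto)
    also have "\<dots> \<noteq> 0"
      using r[OF m(1)] t_nz[of z m] t_deg[of z m] leading_coeff_0_iff[of "t z m"] by simp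
    finally show ?thesis
      by auto
  qed
  \<comment> \<open>The product handles all shifts at once: its roots are finitely many, so some
    reciprocal of a positive integer is not among them.\<close>
  have "(\<Prod>z\<in>Z. p z) \<noteq> 0"
    using p_nz Z by simp
  then have "finite {x. poly (\<Prod>z\<in>Z. p z) x = 0}"
    by (rule poly_roots_finite)
  moreover have "infinite (range (\<lambda>n. inverse (real (Suc n))))"
    by (intro range_inj_infinite) (simp add: inj_def)
  ultimately obtain n where n: "poly (\<Prod>z\<in>Z. p z) (inverse (real (Suc n))) \<noteq> 0"
    by (metis (mono_tags, lifting) finite_subset mem_Collect_eq rangeE subsetI)
  \<comment> \<open>Thus \<open>inverse (real (q i))\<close> is the chosen non-root raised to the
    power \<open>w i\<close>.\<close>
  define q where "q i = Suc n ^ w i" for i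
  have "(\<Sum>m\<in>K. r m * (\<Prod>i\<in>I. (z i + d i * inverse (real (q i))) ^ e m i)) \<noteq> 0" if "z \<in> Z" for z
  proof -
    have "poly (p z) (inverse (real (Suc n))) \<noteq> 0"
      using n that Z by (auto simp: poly_prod)
    then show ?thesis
      by (simp add: p_def t_def q_def poly_sum poly_prod poly_monom power_inverse del: of_nat_Suc)
  qed
  then show ?thesis
    by blast
qed


section \<open>A family of sequences with arbitrary simultaneous values\<close>

text \<open>The index \<open>n\<close> encodes a length and a finite table; the table is looked up at the initial segment
  of \<open>b\<close> of that length, so that finitely many distinct \<open>b\<close> receive independent values.\<close>

definition probe :: "(nat \<Rightarrow> int) \<Rightarrow> nat \<Rightarrow> real"
  where "probe b n = (case from_nat n :: nat \<times> (int list \<times> nat) list of (l, tab) \<Rightarrow>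
    case map_of tab (map b [0..<l]) of None \<Rightarrow> 0 | Some q \<Rightarrow> inverse (real q))"

lemma probe_bounds: "0 \<le> probe b n" "probe b n \<le> 1"
proof -
  have "inverse (real q) \<le> 1" for q
    by (cases q) (auto simp: inverse_le_1_iff)
  then show "0 \<le> probe b n" "probe b n \<le> 1"
    by (auto simp: probe_def split: prod.split option.split)
qed

lemma distinct_initial_segments:
  assumes "finite B"
  shows "\<forall>\<^sub>F l in sequentially. inj_on (\<lambda>b::nat \<Rightarrow> 'a. map b [0..<l]) B"
proof -
  have "\<forall>\<^sub>F l in sequentially. b \<noteq> b' \<longrightarrow> map b [0..<l] \<noteq> map b' [0..<l]" for b b' :: "nat \<Rightarrow> 'a"
  proof (cases "b = b'")
    case False
    then obtain j where "b j \<noteq> b' j"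
      by blast
    then show ?thesis
      by (intro eventually_sequentiallyI[of "Suc j"]) auto
  qed simp
  then have "\<forall>\<^sub>F l in sequentially. \<forall>b\<in>B. \<forall>b'\<in>B. b \<noteq> b' \<longrightarrow> map b [0..<l] \<noteq> map b' [0..<l]"
    using assms by (simp add: eventually_ball_finite)
  then show ?thesis
    by (rule eventually_mono) (auto simp: inj_on_def)
qed

text \<open>From some length on, the initial segments of the members of \<open>B\<close> differ, so
  a table pairing them with the \<open>q b\<close> is consistent; each further length yields a new
  index. The value 0 is included, since \<open>q b = 0\<close> gives
  \<open>inverse 0 = 0\<close>.\<close>

lemma probe_attains:
  assumes B: "finite B"
  shows "\<exists>\<^sub>F n in sequentially. \<forall>b\<in>B. probe b n = inverse (real (q b))"
proof -
  obtain l0 where l0: "\<And>l. l0 \<le> l \<Longrightarrow> inj_on (\<lambda>b. map b [0..<l]) B"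
    using distinct_initial_segments[OF B] by (auto simp: eventually_sequentially)
  obtain bs where bs: "set bs = B" "distinct bs"
    using finite_distinct_list[OF B] by blast
  define tab where "tab l = map (\<lambda>b. (map b [0..<l], q b)) bs" for l
  define idx where "idx l = to_nat (l0 + l, tab (l0 + l))" for l
  have idx: "probe b (idx l) = inverse (real (q b))" if "b \<in> B" for b l
  proof -
    have "distinct (map fst (tab (l0 + l)))"
      using bs l0[of "l0 + l"] by (simp add: tab_def distinct_map o_def)
    moreover have "(map b [0..<l0 + l], q b) \<in> set (tab (l0 + l))"
      using that bs by (auto simp: tab_def)
    ultimately have "map_of (tab (l0 + l)) (map b [0..<l0 + l]) = Some (q b)"
      by simp
    then show ?thesis
      by (simp add: probe_def idx_def del: upt_add_eq_append)
  qed
  have "inj idx"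
    by (simp add: inj_def idx_def)
  then have "infinite (range idx)"
    by (rule range_inj_infinite)
  moreover have "range idx \<subseteq> {n. \<forall>b\<in>B. probe b n = inverse (real (q b))}"
    using idx by auto
  ultimately show ?thesis
    by (metis (mono_tags, lifting) finite_subset frequently_cofinite cofinite_eq_sequentially)
qed


section \<open>The generators\<close>

text \<open>\<open>b 0\<close> encodes the precision, and the remaining entries an approximated sequence.\<close>

definition index_set :: "(nat \<Rightarrow> int) set"
  where "index_set = {b. finite (range b)}"

definition scale :: "(nat \<Rightarrow> int) \<Rightarrow> real"
  where "scale b = inverse (real_of_int \<bar>b 0\<bar> + 1)"

text \<open>The first summand lies on a grid of mesh \<open>scale b\<close> and, for
  \<open>b\<close> in \<open>index_set\<close>, takes finitely many values; the second is a
  perturbation by at most one mesh.\<close>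

definition gen :: "(nat \<Rightarrow> int) \<Rightarrow> linfty"
  where "gen b = Bcontfun (\<lambda>n. scale b * b (Suc n) + scale b * probe b n)"

lemma scale_pos: "0 < scale b"
  by (simp add: scale_def add_nonneg_pos)

lemma apply_gen:
  assumes "b \<in> index_set"
  shows "apply_bcontfun (gen b) n = scale b * b (Suc n) + scale b * probe b n"
proof -
  have "finite (range (\<lambda>n. scale b * b (Suc n)))"
    using assms by (rule_tac finite_subset[of _ "(\<lambda>x. scale b * real_of_int x) ` range b"])
      (auto simp: index_set_def)
  then have "bounded (range (\<lambda>n. scale b * b (Suc n)))"
    by (rule finite_imp_bounded)
  moreover have "bounded (range (\<lambda>n. scale b * probe b n))"
    unfolding bounded_iff
    using probe_bounds scale_pos[of b]
    by (intro exI[of _ "scale b"]) (auto simp: abs_mult mult_left_le)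
  ultimately have "bounded (range (\<lambda>n. scale b * b (Suc n) + scale b * probe b n))"
    by (rule bounded_plus_comp)
  then show ?thesis
    by (simp add: gen_def Bcontfun_inverse bcontfun_def)
qed

text \<open>At a suitable common position the probes make equality arithmetically impossible,
  whatever the integers \<open>b (Suc n)\<close> and \<open>b' (Suc n)\<close> are.\<close>

lemma inj_on_gen: "inj_on gen index_set"
proof (rule inj_onI, rule ccontr)
  fix b b' assume b: "b \<in> index_set" "b' \<in> index_set" "gen b = gen b'" "b \<noteq> b'"
  define s s' where "s = \<bar>b 0\<bar> + 1" and "s' = \<bar>b' 0\<bar> + 1"
  have pos: "0 < s" "0 < s'"
    by (auto simp: s_def s'_def)
  have scale: "scale b = inverse (real_of_int s)" "scale b' = inverse (real_of_int s')"
    by (auto simp: scale_def s_def s'_def)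
  \<comment> \<open>Since \<open>s' + 1\<close> is coprime to \<open>s'\<close>, the equation with
    cleared denominators fails modulo \<open>s' + 1\<close>; the entry 0 makes the probe of
    \<open>b'\<close> vanish.\<close>
  have "\<exists>\<^sub>F n in sequentially. \<forall>x\<in>{b, b'}. probe x n = inverse (real (if x = b then nat (s' + 1) else 0))"
    by (rule probe_attains) simp
  then obtain n where n: "probe b n = inverse (real (nat (s' + 1)))" "probe b' n = 0"
    using b(4) by (auto dest!: frequently_ex)
  have "(b (Suc n) + inverse (real_of_int (s' + 1))) / s = b' (Suc n) / s'"
    using apply_gen[OF b(1), of n] apply_gen[OF b(2), of n] b(3) n pos
    by (simp add: scale divide_inverse algebra_simps)
  moreover have "real_of_int s \<noteq> 0" "real_of_int s' \<noteq> 0" "real_of_int (s' + 1) \<noteq> 0"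
    using pos by linarith+
  ultimately have "real_of_int (s' * ((s' + 1) * b (Suc n) + 1)) = real_of_int ((s' + 1) * s * b' (Suc n))"
    by (simp add: divide_simps del: of_int_add) (simp add: algebra_simps)
  then have "s' * ((s' + 1) * b (Suc n) + 1) = (s' + 1) * s * b' (Suc n)"
    by (simp only: of_int_eq_iff)
  then have "1 = (s' + 1) * (s' * b (Suc n) + 1 - s * b' (Suc n))"
    by (simp add: algebra_simps)
  then have "s' + 1 dvd 1"
    by (metis dvd_triv_left)
  then show False
    using pos by simp
qed

text \<open>Upper bound: a function is coded by its graph as a set of naturals. Lower bound:
  indicator functions of sets of naturals have finite range.\<close>

lemma index_set_eqpoll_reals: "index_set \<approx> (UNIV :: real set)"
proof (rule lepoll_antisym)
  have "inj_on (\<lambda>b. to_nat ` range (\<lambda>n. (n, b n))) index_set"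
  proof (rule inj_onI)
    fix b b' :: "nat \<Rightarrow> int"
    assume "to_nat ` range (\<lambda>n. (n, b n)) = to_nat ` range (\<lambda>n. (n, b' n))"
    then have "range (\<lambda>n. (n, b n)) = range (\<lambda>n. (n, b' n))"
      by (simp add: inj_image_eq_iff)
    then show "b = b'"
      by (auto simp: fun_eq_iff set_eq_iff image_iff)
  qed
  then have "index_set \<lesssim> (UNIV :: nat set set)"
    unfolding lepoll_def by blast
  then show "index_set \<lesssim> (UNIV :: real set)"
    using nat_sets_eqpoll_reals lepoll_trans2 by blast
  have "inj (\<lambda>A n. of_bool (n \<in> A) :: int)"
    by (auto simp: inj_def fun_eq_iff)
  moreover have "range (\<lambda>A n. of_bool (n \<in> A) :: int) \<subseteq> index_set"
    by (auto simp: index_set_def intro: finite_subset[of _ "{0, 1}"])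
  ultimately have "(UNIV :: nat set set) \<lesssim> index_set"
    unfolding lepoll_def by blast
  then show "(UNIV :: real set) \<lesssim> index_set"
    using nat_sets_eqpoll_reals eqpoll_sym lepoll_trans1 by blast
qed

text \<open>Rounding down to the grid costs at most one mesh, and the probe at most another.\<close>

lemma gen_dense: "closure (gen ` index_set) = UNIV"
proof -
  have "\<exists>y\<in>gen ` index_set. dist y f < \<epsilon>" if "0 < \<epsilon>" for f :: linfty and \<epsilon> :: real
  proof -
    obtain N where "inverse (real (Suc N)) < \<epsilon> / 2"
      using reals_Archimedean half_gt_zero[OF \<open>0 < \<epsilon>\<close>] by metis
    then have N: "2 * inverse (real (Suc N)) < \<epsilon>"
      by simp
    define b where "b n = (case n of 0 \<Rightarrow> int N | Suc n \<Rightarrow> \<lfloor>apply_bcontfun f n * Suc N\<rfloor>)" for n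
    have scale: "scale b = inverse (real (Suc N))"
      by (simp add: scale_def b_def)
    have b_Suc: "b (Suc n) = \<lfloor>apply_bcontfun f n * Suc N\<rfloor>" for n
      by (simp add: b_def)
    \<comment> \<open>Boundedness of \<open>f\<close> confines the rounded values to a finite set of
      integers, as \<open>index_set\<close> requires.\<close>
    have "\<bar>b (Suc n)\<bar> \<le> \<lceil>norm f * Suc N\<rceil> + 1" for n
    proof -
      have "\<bar>apply_bcontfun f n * Suc N\<bar> \<le> norm f * Suc N"
        using norm_bounded[of f n] by (simp add: abs_mult mult_right_mono del: of_nat_Suc)
      then show ?thesis
        unfolding b_Suc by linarith
    qed
    then have "range b \<subseteq> insert (int N) {- (\<lceil>norm f * Suc N\<rceil> + 1)..\<lceil>norm f * Suc N\<rceil> + 1}"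
      by (auto simp: abs_le_iff b_def split: nat.splits) (smt (verit) b_Suc)+
    then have b: "b \<in> index_set"
      by (auto simp: index_set_def intro: finite_subset)
    have "dist (gen b) f \<le> 2 * inverse (real (Suc N))"
    proof (rule dist_bound)
      fix n
      have "apply_bcontfun (gen b) n - apply_bcontfun f n
          = inverse (real (Suc N)) * (b (Suc n) - apply_bcontfun f n * Suc N + probe b n)"
        by (simp add: apply_gen[OF b] scale field_simps del: of_nat_Suc)
      moreover have "\<bar>b (Suc n) - apply_bcontfun f n * Suc N + probe b n\<bar> \<le> 2"
        using probe_bounds[of b n] unfolding b_Suc by linarith
      ultimately show "dist (apply_bcontfun (gen b) n) (apply_bcontfun f n) \<le> 2 * inverse (real (Suc N))"
        by (simp add: dist_real_def abs_mult mult_right_mono mult.commute del: of_nat_Suc)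
    qed
    then show ?thesis
      using b N by (auto intro!: bexI[of _ b])
  qed
  then show ?thesis
    by (auto simp: closure_approachable)
qed


section \<open>Polynomials in the generators\<close>

lemma apply_bcontfun_sum:
  "apply_bcontfun (sum f A) x = (\<Sum>a\<in>A. apply_bcontfun (f a) x)"
  by (induction A rule: infinite_finite_induct) auto

lemma apply_bcontfun_power:
  fixes f :: "'a::topological_space \<Rightarrow>\<^sub>C 'b::{real_normed_algebra_1, comm_ring_1}"
  shows "apply_bcontfun (f ^ n) x = apply_bcontfun f x ^ n"
  by (induction n) auto

lemma apply_bcontfun_prod:
  fixes f :: "'c \<Rightarrow> 'a::topological_space \<Rightarrow>\<^sub>C 'b::{real_normed_algebra_1, comm_ring_1}"
  shows "apply_bcontfun (prod f A) x = (\<Prod>a\<in>A. apply_bcontfun (f a) x)"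
  by (induction A rule: infinite_finite_induct) auto

text \<open>Arbitrary index types let this serve twice: for polynomials in \<open>k\<close>
  variables, and for linear combinations of monomials indexed by the monomials themselves.\<close>

lemma polynomial_in_gens_notin_c0:
  fixes r :: "'m \<Rightarrow> real" and e :: "'m \<Rightarrow> 'i \<Rightarrow> nat" and h :: "'i \<Rightarrow> linfty"
  assumes I: "finite I" and h: "inj_on h I" "h ` I \<subseteq> gen ` index_set"
    and K: "finite K" "K \<noteq> {}" and r: "\<And>m. m \<in> K \<Longrightarrow> r m \<noteq> 0"
    and sep: "\<And>m m'. m \<in> K \<Longrightarrow> m' \<in> K \<Longrightarrow> (\<And>i. i \<in> I \<Longrightarrow> e m i = e m' i) \<Longrightarrow> m = m'"
  shows "(\<Sum>m\<in>K. r m *\<^sub>R (\<Prod>i\<in>I. h i ^ e m i)) \<notin> c0"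
proof
  define f where "f = (\<Sum>m\<in>K. r m *\<^sub>R (\<Prod>i\<in>I. h i ^ e m i))"
  assume "f \<in> c0"
  then have lim: "(\<lambda>n. apply_bcontfun f n) \<longlonglongrightarrow> 0"
    by (simp add: c0_def)
  define b where "b i = inv_into index_set gen (h i)" for i
  have b: "b i \<in> index_set" "h i = gen (b i)" if "i \<in> I" for i
    using h(2) that by (auto simp: b_def inv_into_into f_inv_into_f image_subset_iff)
  have b_inj: "inj_on b I"
    using h(1) b(2) by (auto simp: inj_on_def)
  \<comment> \<open>\<open>z n\<close> collects the grid parts of the generators at
    \<open>n\<close>; restricting the function to \<open>I\<close> places it in a finite product of
    finite sets.\<close>
  define z where "z n = (\<lambda>i\<in>I. scale (b i) * b i (Suc n))" for n
  have "range z \<subseteq> (\<Pi>\<^sub>E i\<in>I. (\<lambda>x. scale (b i) * real_of_int x) ` range (b i))"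
    by (auto simp: z_def)
  moreover have "finite (\<Pi>\<^sub>E i\<in>I. (\<lambda>x. scale (b i) * real_of_int x) ` range (b i))"
    using I b by (intro finite_PiE) (auto simp: index_set_def)
  ultimately have Z: "finite (range z)"
    by (rule finite_subset)
  define F where "F q y = (\<Sum>m\<in>K. r m * (\<Prod>i\<in>I. (y i + scale (b i) * inverse (real (q i))) ^ e m i))"
    for q :: "'i \<Rightarrow> nat" and y
  have scale_nz: "scale (b i) \<noteq> 0" if "i \<in> I" for i
    using scale_pos[of "b i"] by simp
  have "\<exists>q. \<forall>y\<in>range z. F q y \<noteq> 0"
    unfolding F_def by (rule common_nonzero_of_shifts) (fact I K r sep scale_nz Z)+
  then obtain q where q: "\<forall>y\<in>range z. F q y \<noteq> 0"
    by blast
  \<comment> \<open>This finite set omits 0, so its complement is a neighbourhood of the limit 0,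
    yet the probes bring \<open>f\<close> into the set infinitely often.\<close>
  have "closed (F q ` range z)"
    by (intro finite_imp_closed finite_imageI Z)
  then have "\<forall>\<^sub>F n in sequentially. apply_bcontfun f n \<in> - (F q ` range z)"
    using q by (intro topological_tendstoD[OF lim]) auto
  moreover have "\<exists>\<^sub>F n in sequentially. \<forall>x\<in>b ` I. probe x n = inverse (real (q (inv_into I b x)))"
    by (intro probe_attains finite_imageI I)
  ultimately have "\<exists>\<^sub>F n in sequentially. (\<forall>x\<in>b ` I. probe x n = inverse (real (q (inv_into I b x))))
      \<and> apply_bcontfun f n \<in> - (F q ` range z)"
    using frequently_eventually_frequently by blast
  then obtain n where n: "\<forall>x\<in>b ` I. probe x n = inverse (real (q (inv_into I b x)))"
    "apply_bcontfun f n \<in> - (F q ` range z)"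
    by (auto dest!: frequently_ex)
  have "apply_bcontfun (h i) n = z n i + scale (b i) * inverse (real (q i))" if "i \<in> I" for i
    using n(1) that b[OF that] b_inj by (simp add: apply_gen z_def)
  then have "apply_bcontfun f n = F q (z n)"
    by (auto simp: f_def F_def apply_bcontfun_sum apply_bcontfun_prod apply_bcontfun_power
        intro!: sum.cong prod.cong)
  then show False
    using n(2) by auto
qed

lemma alg_independent_gens: "alg_independent (gen ` index_set)"
  unfolding alg_independent_def
proof (intro allI impI ballI)
  fix k :: nat and P and g :: "nat \<Rightarrow> linfty"
  assume P: "P \<in> polys k" "P \<noteq> 0 \<and> poly_eval k P (\<lambda>_. 0::real) = 0"
    and g: "inj_on g {..<k} \<and> g ` {..<k} \<subseteq> gen ` index_set"
  have "m = m'" if "m \<in> Poly_Mapping.keys P" "m' \<in> Poly_Mapping.keys P"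
    "\<And>i. i \<in> {..<k} \<Longrightarrow> Poly_Mapping.lookup m i = Poly_Mapping.lookup m' i" for m m'
  proof (rule poly_mapping_eqI)
    fix i
    show "Poly_Mapping.lookup m i = Poly_Mapping.lookup m' i"
    proof (cases "i < k")
      case False
      then have "i \<notin> Poly_Mapping.keys m" "i \<notin> Poly_Mapping.keys m'"
        using P(1) that(1,2) by (auto simp: polys_def)
      then show ?thesis
        by (simp add: in_keys_iff)
    qed (use that in simp)
  qed
  then have "poly_eval k P g \<notin> c0"
    unfolding poly_eval_def using g P(2)
    by (intro polynomial_in_gens_notin_c0) (auto simp: in_keys_iff)
  then show "poly_eval k P g \<noteq> 0"
    by (auto simp: c0_def)
qed

text \<open>Factors in \<open>monomials_of\<close> may repeat; collecting equal ones gives an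
  exponent function on the generators, so that monomials can be compared over a common finite
  set.\<close>

lemma monomials_of_exponents:
  fixes a :: "'a::{real_algebra_1, comm_ring_1}"
  assumes "a \<in> monomials_of G"
  shows "\<exists>e. finite {x. 0 < e x} \<and> {x. 0 < e x} \<subseteq> G \<and> a = (\<Prod>x | 0 < e x. x ^ e x)"
proof -
  obtain k :: nat and g n where a: "a = (\<Prod>i<k. g i ^ n i)" "\<forall>i<k. g i \<in> G \<and> 1 \<le> n i"
    using assms unfolding monomials_of_def mem_Collect_eq by blast
  define e where "e x = (\<Sum>i | i < k \<and> g i = x. n i)" for x
  have "a = (\<Prod>x\<in>g ` {..<k}. \<Prod>i | i \<in> {..<k} \<and> g i = x. g i ^ n i)"
    unfolding a(1) by (rule prod.image_gen) simp
  also have "\<dots> = (\<Prod>x\<in>g ` {..<k}. x ^ e x)"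
    by (intro prod.cong refl) (auto simp: e_def power_sum)
  finally have a_eq: "a = (\<Prod>x\<in>g ` {..<k}. x ^ e x)" .
  have support: "{x. 0 < e x} \<subseteq> g ` {..<k}"
  proof
    fix x
    assume "x \<in> {x. 0 < e x}"
    then have "{i. i < k \<and> g i = x} \<noteq> {}"
      unfolding e_def by (metis less_irrefl mem_Collect_eq sum.empty)
    then show "x \<in> g ` {..<k}"
      by auto
  qed
  then have "(\<Prod>x\<in>g ` {..<k}. x ^ e x) = (\<Prod>x | 0 < e x. x ^ e x)"
    by (intro prod.mono_neutral_right) auto
  then show ?thesis
    using a(2) a_eq support by (intro exI[of _ e]) (auto intro: finite_subset)
qed

text \<open>A nonempty combination of distinct monomials with non-zero coefficients lies outside
  \<open>c0\<close>, so only the empty one remains.\<close>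

lemma generated_subalgebra_Int_c0:
  assumes "x \<in> generated_subalgebra (gen ` index_set)" "x \<in> c0"
  shows "x = 0"
proof -
  obtain t r where t: "finite t" "t \<subseteq> monomials_of (gen ` index_set)" and x: "x = (\<Sum>a\<in>t. r a *\<^sub>R a)"
    using assms(1) unfolding generated_subalgebra_def span_explicit by blast
  have "\<forall>a\<in>t. \<exists>e. finite {y. 0 < e y} \<and> {y. 0 < e y} \<subseteq> gen ` index_set
      \<and> a = (\<Prod>y | 0 < e y. y ^ e y)"
    using monomials_of_exponents t(2) by blast
  then obtain e :: "linfty \<Rightarrow> linfty \<Rightarrow> nat" where e: "\<forall>a\<in>t. finite {y. 0 < e a y} \<and>
      {y. 0 < e a y} \<subseteq> gen ` index_set \<and> a = (\<Prod>y | 0 < e a y. y ^ e a y)"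
    by (rule bchoice[THEN exE])
  define I where "I = (\<Union>a\<in>t. {y. 0 < e a y})"
  define K where "K = {a\<in>t. r a \<noteq> 0}"
  have I: "finite I" "I \<subseteq> gen ` index_set"
    using e t(1) by (auto simp: I_def)
  have a_eq: "a = (\<Prod>y\<in>I. y ^ e a y)" if "a \<in> t" for a
  proof -
    have "(\<Prod>y | 0 < e a y. y ^ e a y) = (\<Prod>y\<in>I. y ^ e a y)"
      using that I(1) by (intro prod.mono_neutral_left) (auto simp: I_def)
    then show ?thesis
      using e that by metis
  qed
  have "x = (\<Sum>a\<in>K. r a *\<^sub>R a)"
    unfolding x using t(1) by (intro sum.mono_neutral_right) (auto simp: K_def)
  also have "\<dots> = (\<Sum>a\<in>K. r a *\<^sub>R (\<Prod>y\<in>I. y ^ e a y))"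
    using a_eq by (intro sum.cong) (auto simp: K_def)
  finally have x_eq: "x = (\<Sum>a\<in>K. r a *\<^sub>R (\<Prod>y\<in>I. y ^ e a y))" .
  \<comment> \<open>Each monomial is its own index and is determined by its exponents on
    \<open>I\<close>, which gives the required separation.\<close>
  have "a = a'" if "a \<in> K" "a' \<in> K" "\<And>y. y \<in> I \<Longrightarrow> e a y = e a' y" for a a'
  proof -
    have "(\<Prod>y\<in>I. y ^ e a y) = (\<Prod>y\<in>I. y ^ e a' y)"
      using that(3) by simp
    then show ?thesis
      using a_eq[of a] a_eq[of a'] that(1,2) by (simp add: K_def)
  qed
  then have "x \<notin> c0" if "K \<noteq> {}"
    unfolding x_eq using I t(1) that
    by (intro polynomial_in_gens_notin_c0) (auto simp: K_def)
  then show ?thesis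
    using assms(2) x_eq by force
qed

theorem theorem1p3:
  shows "densely_strongly_c_algebrable ((UNIV :: linfty set) - c0)"
  unfolding densely_strongly_c_algebrable_def
proof (intro exI conjI)
  let ?G = "gen ` index_set" and ?A = "generated_subalgebra (gen ` index_set)"
  show "subalgebra ?A"
    by (rule subalgebra_generated)
  show "?A \<subseteq> UNIV - c0 \<union> {0}"
    using generated_subalgebra_Int_c0 by blast
  have "?G \<subseteq> ?A"
    by (simp add: generated_subalgebra_eq_hull hull_subset)
  then show "closure ?A = UNIV"
    using gen_dense closure_mono by blast
  show "alg_independent ?G"
    by (rule alg_independent_gens)
  show "?G \<approx> (UNIV :: real set)"
    using inj_on_image_eqpoll_self[OF inj_on_gen] index_set_eqpoll_reals by (rule eqpoll_trans)
qed (rule refl)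

end
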